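(* Let $(M,g,J,\omega)$ be a quasi-Kähler manifold, let $\nabla$ be the Levi-Civita connection of $g$, $R$ the Riemann curvature tensor of $g$, $\widetilde{R}$ the Hermitian curvature tensor and $N$ the Nijenhuis tensor of $J$. The Hermitian curvature tensor satisfies the first Bianchi identity $$\widetilde{R}(X,Y,Z,\cdot)+\widetilde{R}(Y,Z,X,\cdot)+\widetilde{R}(Z,X,Y,\cdot)=0\quad\text{for every }X,Y,Z\in\Gamma(TM)$$ if and only if both of the following conditions hold: 1. $R(\overline{Z}_1,Z_2,Z_3,Z_4)=0$ for every $Z_1,Z_2,Z_3,Z_4\in\Gamma(T^{1,0}M)$ (third Gray identity); 2. $R(Z_1,Z_2,\overline{Z}_3,\overline{Z}_4)=\frac14 F(\overline{Z}_3,Z_1,Z_2,\overline{Z}_4)$ for every $Z_1,Z_2,Z_3,Z_4\in\Gamma(T^{1,0}M)$, where $F$ is the tensor $F(X,Y,Z,W):=g((\nabla_XN)(Y,Z),W)$.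
   Context: An almost Hermitian manifold $(M,g,J,\omega)$ is a smooth manifold with an almost complex structure $J$, a Riemannian metric $g$ preserved by $J$, and the 2-form $\omega(\cdot,\cdot)=g(J\cdot,\cdot)$. $T^{1,0}M$ and $T^{0,1}M$ are the $i$- and $-i$-eigenbundles of $J$ on $TM\otimes\mathbb{C}$; all tensors and connections are extended complex-(multi)linearly. The structure is quasi-Kähler if $\overline{\partial}\omega=(d\omega)^{1,2}=0$, the $(1,2)$-component of $d\omega$. Nijenhuis tensor: $N(X,Y)=[JX,JY]-J[JX,Y]-J[X,JY]-[X,Y]$. Riemann curvature: $R(X,Y,Z,W)=g(\nabla_X\nabla_YZ-\nabla_Y\nabla_XZ-\nabla_{[X,Y]}Z,W)$. The canonical connection $\widetilde\nabla$ of $(g,J)$ is the unique linear connection with $\widetilde\nabla g=0$, $\widetilde\nabla J=0$ and vanishing $(1,1)$-part of the torsion; in the quasi-Kähler case $\widetilde\nabla=\nabla-\frac12J\nabla J$, i.e. $\widetilde\nabla_XY=\nabla_XY-\frac12J(\nabla_XJ)Y=\frac12(\nabla_XY-J\nabla_X(JY))$. The Hermitian curvature tensor is $\widetilde R(X,Y,Z,W)=g(\widetilde\nabla_X\widetilde\nabla_YZ-\widetilde\nabla_Y\widetilde\nabla_XZ-\widetilde\nabla_{[X,Y]}Z,W)$. *)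

theory Defs
  imports "HOL-Analysis.Analysis" "HOL-Library.Function_Algebras"
begin

text \<open>
  A smooth manifold is a Hausdorff second countable type \<open>'a\<close> with a smooth atlas of charts
  \<open>(U, \<phi>)\<close> into a Euclidean space \<open>'e\<close>. Tangent vectors at \<open>p\<close> are derivations at \<open>p\<close> of the
  algebra of smooth functions; sums, differences and products of functions are pointwise.
\<close>

text \<open>\<open>S\<close> is meant to be open.\<close>

primrec Ck_on :: "nat \<Rightarrow> 'e::euclidean_space set \<Rightarrow> ('e \<Rightarrow> 'f::real_normed_vector) \<Rightarrow> bool" where
  "Ck_on 0 S f \<longleftrightarrow> continuous_on S f"
| "Ck_on (Suc k) S f \<longleftrightarrow>
     (\<forall>x\<in>S. f differentiable (at x)) \<and> (\<forall>v. Ck_on k S (\<lambda>x. frechet_derivative f (at x) v))"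

definition smooth_on :: "'e::euclidean_space set \<Rightarrow> ('e \<Rightarrow> 'f::real_normed_vector) \<Rightarrow> bool" where
  "smooth_on S f \<longleftrightarrow> (\<forall>k. Ck_on k S f)"

type_synonym ('a, 'e) chart = "'a set \<times> ('a \<Rightarrow> 'e)"

definition is_chart :: "('a::topological_space, 'e::euclidean_space) chart \<Rightarrow> bool" where
  "is_chart c \<longleftrightarrow> (case c of (U, \<phi>) \<Rightarrow>
     open U \<and> open (\<phi> ` U) \<and> homeomorphism U (\<phi> ` U) \<phi> (inv_into U \<phi>))"

definition smooth_atlas :: "('a::topological_space, 'e::euclidean_space) chart set \<Rightarrow> bool" where
  "smooth_atlas A \<longleftrightarrow>
     (\<forall>c\<in>A. is_chart c) \<and> (\<Union>(U, \<phi>)\<in>A. U) = UNIV \<and>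
     (\<forall>(U, \<phi>)\<in>A. \<forall>(V, \<psi>)\<in>A. smooth_on (\<phi> ` (U \<inter> V)) (\<psi> \<circ> inv_into U \<phi>))"

definition smooth_fun :: "('a, 'e::euclidean_space) chart set \<Rightarrow> ('a \<Rightarrow> real) \<Rightarrow> bool" where
  "smooth_fun A f \<longleftrightarrow> (\<forall>(U, \<phi>)\<in>A. smooth_on (\<phi> ` U) (f \<circ> inv_into U \<phi>))"

type_synonym 'a tvec = "('a \<Rightarrow> real) \<Rightarrow> real"
type_synonym 'a field = "'a \<Rightarrow> 'a tvec"

text \<open>
  A derivation is only meaningful on smooth functions; it is set to \<open>0\<close> elsewhere, so that
  equality of tangent vectors is equality of HOL functions.
\<close>

definition tangent_space :: "('a, 'e::euclidean_space) chart set \<Rightarrow> 'a \<Rightarrow> 'a tvec set" where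
  "tangent_space A p = {v.
     (\<forall>f h. smooth_fun A f \<longrightarrow> smooth_fun A h \<longrightarrow>
        v (f + h) = v f + v h \<and> v (f * h) = f p * v h + h p * v f) \<and>
     (\<forall>c f. smooth_fun A f \<longrightarrow> v (\<lambda>q. c * f q) = c * v f) \<and>
     (\<forall>f. \<not> smooth_fun A f \<longrightarrow> v f = 0)}"

definition vector_fields :: "('a, 'e::euclidean_space) chart set \<Rightarrow> 'a field set" where
  "vector_fields A = {X. (\<forall>p. X p \<in> tangent_space A p) \<and>
     (\<forall>f. smooth_fun A f \<longrightarrow> smooth_fun A (\<lambda>p. X p f))}"

definition scale_field :: "('a \<Rightarrow> real) \<Rightarrow> 'a field \<Rightarrow> 'a field" where
  "scale_field f X = (\<lambda>p h. f p * X p h)"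

definition deriv_along :: "'a field \<Rightarrow> ('a \<Rightarrow> real) \<Rightarrow> 'a \<Rightarrow> real" where
  "deriv_along X f = (\<lambda>p. X p f)"

definition bracket :: "'a field \<Rightarrow> 'a field \<Rightarrow> 'a field" where
  "bracket X Y = (\<lambda>p f. X p (deriv_along Y f) - Y p (deriv_along X f))"

definition metric_on :: "('a \<Rightarrow> 'a tvec \<Rightarrow> 'a tvec \<Rightarrow> real) \<Rightarrow> 'a field \<Rightarrow> 'a field \<Rightarrow> 'a \<Rightarrow> real" where
  "metric_on g X Y = (\<lambda>p. g p (X p) (Y p))"

definition endo_on :: "('a \<Rightarrow> 'a tvec \<Rightarrow> 'a tvec) \<Rightarrow> 'a field \<Rightarrow> 'a field" where
  "endo_on J X = (\<lambda>p. J p (X p))"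

definition riemannian_metric ::
  "('a, 'e::euclidean_space) chart set \<Rightarrow> ('a \<Rightarrow> 'a tvec \<Rightarrow> 'a tvec \<Rightarrow> real) \<Rightarrow> bool" where
  "riemannian_metric A g \<longleftrightarrow>
     (\<forall>p. \<forall>u\<in>tangent_space A p. \<forall>v\<in>tangent_space A p. \<forall>w\<in>tangent_space A p. \<forall>c.
        g p u v = g p v u \<and>
        g p u (v + w) = g p u v + g p u w \<and>
        g p u (\<lambda>h. c * v h) = c * g p u v \<and>
        (u \<noteq> 0 \<longrightarrow> g p u u > 0)) \<and>
     (\<forall>X\<in>vector_fields A. \<forall>Y\<in>vector_fields A. smooth_fun A (metric_on g X Y))"

definition almost_complex_structure ::
  "('a, 'e::euclidean_space) chart set \<Rightarrow> ('a \<Rightarrow> 'a tvec \<Rightarrow> 'a tvec) \<Rightarrow> bool" where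
  "almost_complex_structure A J \<longleftrightarrow>
     (\<forall>p. \<forall>u\<in>tangent_space A p. \<forall>v\<in>tangent_space A p. \<forall>c.
        J p u \<in> tangent_space A p \<and>
        J p (u + v) = J p u + J p v \<and>
        J p (\<lambda>h. c * u h) = (\<lambda>h. c * J p u h) \<and>
        J p (J p u) = - u) \<and>
     (\<forall>X\<in>vector_fields A. endo_on J X \<in> vector_fields A)"

definition almost_hermitian ::
  "('a, 'e::euclidean_space) chart set \<Rightarrow> ('a \<Rightarrow> 'a tvec \<Rightarrow> 'a tvec \<Rightarrow> real) \<Rightarrow>
   ('a \<Rightarrow> 'a tvec \<Rightarrow> 'a tvec) \<Rightarrow> bool" where
  "almost_hermitian A g J \<longleftrightarrow>
     riemannian_metric A g \<and> almost_complex_structure A J \<and>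
     (\<forall>p. \<forall>u\<in>tangent_space A p. \<forall>v\<in>tangent_space A p. g p (J p u) (J p v) = g p u v)"

definition fundamental_form ::
  "('a \<Rightarrow> 'a tvec \<Rightarrow> 'a tvec \<Rightarrow> real) \<Rightarrow> ('a \<Rightarrow> 'a tvec \<Rightarrow> 'a tvec) \<Rightarrow>
   'a field \<Rightarrow> 'a field \<Rightarrow> 'a \<Rightarrow> real" where
  "fundamental_form g J X Y = metric_on g (endo_on J X) Y"

definition ext_deriv2 ::
  "('a field \<Rightarrow> 'a field \<Rightarrow> 'a \<Rightarrow> real) \<Rightarrow> 'a field \<Rightarrow> 'a field \<Rightarrow> 'a field \<Rightarrow> 'a \<Rightarrow> real" where
  "ext_deriv2 \<alpha> X Y Z =
     deriv_along X (\<alpha> Y Z) - deriv_along Y (\<alpha> X Z) + deriv_along Z (\<alpha> X Y)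
     - \<alpha> (bracket X Y) Z + \<alpha> (bracket X Z) Y - \<alpha> (bracket Y Z) X"

definition nijenhuis :: "('a \<Rightarrow> 'a tvec \<Rightarrow> 'a tvec) \<Rightarrow> 'a field \<Rightarrow> 'a field \<Rightarrow> 'a field" where
  "nijenhuis J X Y =
     bracket (endo_on J X) (endo_on J Y) - endo_on J (bracket (endo_on J X) Y)
     - endo_on J (bracket X (endo_on J Y)) - bracket X Y"

type_synonym 'a connection = "'a field \<Rightarrow> 'a field \<Rightarrow> 'a field"

definition linear_connection ::
  "('a, 'e::euclidean_space) chart set \<Rightarrow> 'a connection \<Rightarrow> bool" where
  "linear_connection A D \<longleftrightarrow>
     (\<forall>X\<in>vector_fields A. \<forall>Y\<in>vector_fields A. \<forall>Z\<in>vector_fields A. \<forall>f. smooth_fun A f \<longrightarrow>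
        D X Y \<in> vector_fields A \<and>
        D (X + Y) Z = D X Z + D Y Z \<and>
        D (scale_field f X) Y = scale_field f (D X Y) \<and>
        D X (Y + Z) = D X Y + D X Z \<and>
        D X (scale_field f Y) = scale_field (deriv_along X f) Y + scale_field f (D X Y))"

definition torsion :: "'a connection \<Rightarrow> 'a field \<Rightarrow> 'a field \<Rightarrow> 'a field" where
  "torsion D X Y = D X Y - D Y X - bracket X Y"

definition cov_metric ::
  "'a connection \<Rightarrow> ('a \<Rightarrow> 'a tvec \<Rightarrow> 'a tvec \<Rightarrow> real) \<Rightarrow>
   'a field \<Rightarrow> 'a field \<Rightarrow> 'a field \<Rightarrow> 'a \<Rightarrow> real" where
  "cov_metric D g X Y Z =
     deriv_along X (metric_on g Y Z) - metric_on g (D X Y) Z - metric_on g Y (D X Z)"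

definition cov_endo ::
  "'a connection \<Rightarrow> ('a \<Rightarrow> 'a tvec \<Rightarrow> 'a tvec) \<Rightarrow> 'a field \<Rightarrow> 'a field \<Rightarrow> 'a field" where
  "cov_endo D J X Y = D X (endo_on J Y) - endo_on J (D X Y)"

definition cov_tensor2 ::
  "'a connection \<Rightarrow> ('a field \<Rightarrow> 'a field \<Rightarrow> 'a field) \<Rightarrow>
   'a field \<Rightarrow> 'a field \<Rightarrow> 'a field \<Rightarrow> 'a field" where
  "cov_tensor2 D T X Y Z = D X (T Y Z) - T (D X Y) Z - T Y (D X Z)"

definition levi_civita ::
  "('a, 'e::euclidean_space) chart set \<Rightarrow> ('a \<Rightarrow> 'a tvec \<Rightarrow> 'a tvec \<Rightarrow> real) \<Rightarrow>
   'a connection \<Rightarrow> bool" where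
  "levi_civita A g D \<longleftrightarrow> linear_connection A D \<and>
     (\<forall>X\<in>vector_fields A. \<forall>Y\<in>vector_fields A. \<forall>Z\<in>vector_fields A. cov_metric D g X Y Z = 0) \<and>
     (\<forall>X\<in>vector_fields A. \<forall>Y\<in>vector_fields A. torsion D X Y = 0)"

definition curvature ::
  "('a \<Rightarrow> 'a tvec \<Rightarrow> 'a tvec \<Rightarrow> real) \<Rightarrow> 'a connection \<Rightarrow>
   'a field \<Rightarrow> 'a field \<Rightarrow> 'a field \<Rightarrow> 'a field \<Rightarrow> 'a \<Rightarrow> real" where
  "curvature g D X Y Z W = metric_on g (D X (D Y Z) - D Y (D X Z) - D (bracket X Y) Z) W"

text \<open>The tensor \<open>F\<close>; here \<open>D\<close> is meant to be the Levi-Civita connection.\<close>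

definition nijenhuis_deriv ::
  "('a \<Rightarrow> 'a tvec \<Rightarrow> 'a tvec \<Rightarrow> real) \<Rightarrow> ('a \<Rightarrow> 'a tvec \<Rightarrow> 'a tvec) \<Rightarrow> 'a connection \<Rightarrow>
   'a field \<Rightarrow> 'a field \<Rightarrow> 'a field \<Rightarrow> 'a field \<Rightarrow> 'a \<Rightarrow> real" where
  "nijenhuis_deriv g J D X Y Z W = metric_on g (cov_tensor2 D (nijenhuis J) X Y Z) W"

text \<open>
  An element of \<open>TM \<otimes> \<complex>\<close> is represented by the complex-valued derivation
  \<open>f \<mapsto> v f + \<i> * w f\<close>, where \<open>v\<close> and \<open>w\<close> are its real and imaginary parts in \<open>TM\<close>.
\<close>

type_synonym 'a cfield = "'a \<Rightarrow> ('a \<Rightarrow> real) \<Rightarrow> complex"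

definition re_field :: "'a cfield \<Rightarrow> 'a field" where
  "re_field Z = (\<lambda>p f. Re (Z p f))"

definition im_field :: "'a cfield \<Rightarrow> 'a field" where
  "im_field Z = (\<lambda>p f. Im (Z p f))"

definition cnj_field :: "'a cfield \<Rightarrow> 'a cfield" where
  "cnj_field Z = (\<lambda>p f. cnj (Z p f))"

definition cvector_fields :: "('a, 'e::euclidean_space) chart set \<Rightarrow> 'a cfield set" where
  "cvector_fields A = {Z. re_field Z \<in> vector_fields A \<and> im_field Z \<in> vector_fields A}"

text \<open>
  Complex-linear extension of a real-linear map, and, one argument at a time, the
  complex-multilinear extension of a real-multilinear one.
\<close>

definition cext :: "('a field \<Rightarrow> complex) \<Rightarrow> 'a cfield \<Rightarrow> complex" where
  "cext T Z = T (re_field Z) + \<i> * T (im_field Z)"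

definition cext2 ::
  "('a field \<Rightarrow> 'a field \<Rightarrow> complex) \<Rightarrow> 'a cfield \<Rightarrow> 'a cfield \<Rightarrow> complex" where
  "cext2 T Z1 Z2 = cext (\<lambda>X. cext (T X) Z2) Z1"

definition cext3 ::
  "('a field \<Rightarrow> 'a field \<Rightarrow> 'a field \<Rightarrow> complex) \<Rightarrow>
   'a cfield \<Rightarrow> 'a cfield \<Rightarrow> 'a cfield \<Rightarrow> complex" where
  "cext3 T Z1 Z2 Z3 = cext (\<lambda>X. cext2 (T X) Z2 Z3) Z1"

definition cext4 ::
  "('a field \<Rightarrow> 'a field \<Rightarrow> 'a field \<Rightarrow> 'a field \<Rightarrow> complex) \<Rightarrow>
   'a cfield \<Rightarrow> 'a cfield \<Rightarrow> 'a cfield \<Rightarrow> 'a cfield \<Rightarrow> complex" where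
  "cext4 T Z1 Z2 Z3 Z4 = cext (\<lambda>X. cext3 (T X) Z2 Z3 Z4) Z1"

definition cendo_on :: "('a \<Rightarrow> 'a tvec \<Rightarrow> 'a tvec) \<Rightarrow> 'a cfield \<Rightarrow> 'a cfield" where
  "cendo_on J Z = (\<lambda>p f. cext (\<lambda>X. complex_of_real (endo_on J X p f)) Z)"

definition form2_cvalued ::
  "('a field \<Rightarrow> 'a field \<Rightarrow> 'a field) \<Rightarrow> 'a cfield \<Rightarrow> 'a cfield \<Rightarrow> 'a cfield" where
  "form2_cvalued T Z1 Z2 = (\<lambda>p f. cext2 (\<lambda>X Y. complex_of_real (T X Y p f)) Z1 Z2)"

definition form3_c ::
  "('a field \<Rightarrow> 'a field \<Rightarrow> 'a field \<Rightarrow> 'a \<Rightarrow> real) \<Rightarrow>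
   'a cfield \<Rightarrow> 'a cfield \<Rightarrow> 'a cfield \<Rightarrow> 'a \<Rightarrow> complex" where
  "form3_c \<alpha> Z1 Z2 Z3 = (\<lambda>p. cext3 (\<lambda>X Y Z. complex_of_real (\<alpha> X Y Z p)) Z1 Z2 Z3)"

definition tensor4_c ::
  "('a field \<Rightarrow> 'a field \<Rightarrow> 'a field \<Rightarrow> 'a field \<Rightarrow> 'a \<Rightarrow> real) \<Rightarrow>
   'a cfield \<Rightarrow> 'a cfield \<Rightarrow> 'a cfield \<Rightarrow> 'a cfield \<Rightarrow> 'a \<Rightarrow> complex" where
  "tensor4_c T Z1 Z2 Z3 Z4 = (\<lambda>p. cext4 (\<lambda>X Y Z W. complex_of_real (T X Y Z W p)) Z1 Z2 Z3 Z4)"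

definition sections10 ::
  "('a, 'e::euclidean_space) chart set \<Rightarrow> ('a \<Rightarrow> 'a tvec \<Rightarrow> 'a tvec) \<Rightarrow> 'a cfield set" where
  "sections10 A J = {Z \<in> cvector_fields A. cendo_on J Z = (\<lambda>p f. \<i> * Z p f)}"

definition proj10 :: "('a \<Rightarrow> 'a tvec \<Rightarrow> 'a tvec) \<Rightarrow> 'a cfield \<Rightarrow> 'a cfield" where
  "proj10 J Z = (\<lambda>p f. (Z p f - \<i> * cendo_on J Z p f) / 2)"

definition proj01 :: "('a \<Rightarrow> 'a tvec \<Rightarrow> 'a tvec) \<Rightarrow> 'a cfield \<Rightarrow> 'a cfield" where
  "proj01 J Z = (\<lambda>p f. (Z p f + \<i> * cendo_on J Z p f) / 2)"

definition part11 ::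
  "('a \<Rightarrow> 'a tvec \<Rightarrow> 'a tvec) \<Rightarrow> ('a field \<Rightarrow> 'a field \<Rightarrow> 'a field) \<Rightarrow>
   'a cfield \<Rightarrow> 'a cfield \<Rightarrow> 'a cfield" where
  "part11 J T Z1 Z2 =
     form2_cvalued T (proj10 J Z1) (proj01 J Z2) + form2_cvalued T (proj01 J Z1) (proj10 J Z2)"

definition part12 ::
  "('a \<Rightarrow> 'a tvec \<Rightarrow> 'a tvec) \<Rightarrow> ('a field \<Rightarrow> 'a field \<Rightarrow> 'a field \<Rightarrow> 'a \<Rightarrow> real) \<Rightarrow>
   'a cfield \<Rightarrow> 'a cfield \<Rightarrow> 'a cfield \<Rightarrow> 'a \<Rightarrow> complex" where
  "part12 J \<alpha> Z1 Z2 Z3 =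
     form3_c \<alpha> (proj10 J Z1) (proj01 J Z2) (proj01 J Z3) +
     form3_c \<alpha> (proj01 J Z1) (proj10 J Z2) (proj01 J Z3) +
     form3_c \<alpha> (proj01 J Z1) (proj01 J Z2) (proj10 J Z3)"

definition quasi_kaehler ::
  "('a, 'e::euclidean_space) chart set \<Rightarrow> ('a \<Rightarrow> 'a tvec \<Rightarrow> 'a tvec \<Rightarrow> real) \<Rightarrow>
   ('a \<Rightarrow> 'a tvec \<Rightarrow> 'a tvec) \<Rightarrow> bool" where
  "quasi_kaehler A g J \<longleftrightarrow> almost_hermitian A g J \<and>
     (\<forall>Z1\<in>cvector_fields A. \<forall>Z2\<in>cvector_fields A. \<forall>Z3\<in>cvector_fields A.
        part12 J (ext_deriv2 (fundamental_form g J)) Z1 Z2 Z3 = 0)"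

definition canonical_connection ::
  "('a, 'e::euclidean_space) chart set \<Rightarrow> ('a \<Rightarrow> 'a tvec \<Rightarrow> 'a tvec \<Rightarrow> real) \<Rightarrow>
   ('a \<Rightarrow> 'a tvec \<Rightarrow> 'a tvec) \<Rightarrow> 'a connection \<Rightarrow> bool" where
  "canonical_connection A g J D \<longleftrightarrow> linear_connection A D \<and>
     (\<forall>X\<in>vector_fields A. \<forall>Y\<in>vector_fields A. \<forall>Z\<in>vector_fields A. cov_metric D g X Y Z = 0) \<and>
     (\<forall>X\<in>vector_fields A. \<forall>Y\<in>vector_fields A. cov_endo D J X Y = 0) \<and>
     (\<forall>Z1\<in>cvector_fields A. \<forall>Z2\<in>cvector_fields A. part11 J (torsion D) Z1 Z2 = 0)"

end

theory Submission
  imports Defs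
begin

text \<open>
  Let \<open>C\<close> be the difference between the Levi-Civita and the canonical connection and \<open>T\<close> the torsion
  of the latter. For a quasi-Kaehler structure \<open>C\<close> and \<open>T\<close> anticommute with \<open>J\<close> in both arguments, and
  the Nijenhuis tensor is \<open>4 T\<close>. With \<open>E\<close> the canonical connection, the Bianchi identity with torsion
  equates the cyclic sum of the Hermitian curvature with that of
  \<open>(E\<^sub>X T)(Y, Z) + T(T(X, Y), Z)\<close>. Its (3,0) + (0,3) part always vanishes, because the Hermitian
  curvature commutes with \<open>J\<close>; sorting the rest by type, the first Bianchi identity holds iff
  \<open>E\<^bsub>JX\<^esub> T = - J (E\<^sub>X T)\<close> and \<open>T(T(X, Y), Z) = 0\<close>. Expanding the Riemann curvature in terms of the
  Hermitian one, \<open>C\<close> and its covariant derivative, these two equations turn out to be the two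
  conditions of the theorem; \<open>E T\<close> and \<open>E C\<close> determine each other since \<open>C\<close> is skew with
  respect to the metric.
\<close>

text \<open>
  \<open>V\<close> plays the role of the real vector fields, \<open>D\<close> and \<open>E\<close> of the Levi-Civita and the
  canonical connection, and \<open>L X f\<close> of the derivative \<open>X f\<close>. Additivity is all the linearity
  that is needed: no step divides or multiplies a field by a function.
\<close>

locale almost_hermitian_pair =
  fixes V :: "'v::ab_group_add set"
    and g :: "'v \<Rightarrow> 'v \<Rightarrow> 'p \<Rightarrow> real"
    and L :: "'v \<Rightarrow> ('p \<Rightarrow> real) \<Rightarrow> 'p \<Rightarrow> real"
    and J :: "'v \<Rightarrow> 'v"
    and br D E :: "'v \<Rightarrow> 'v \<Rightarrow> 'v"
  assumes add_V [simp]: "X \<in> V \<Longrightarrow> Y \<in> V \<Longrightarrow> X + Y \<in> V"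
    and J_V [simp]: "X \<in> V \<Longrightarrow> J X \<in> V"
    and D_V [simp]: "X \<in> V \<Longrightarrow> Y \<in> V \<Longrightarrow> D X Y \<in> V"
    and E_V [simp]: "X \<in> V \<Longrightarrow> Y \<in> V \<Longrightarrow> E X Y \<in> V"
    and J_add [simp]: "X \<in> V \<Longrightarrow> Y \<in> V \<Longrightarrow> J (X + Y) = J X + J Y"
    and J_J [simp]: "X \<in> V \<Longrightarrow> J (J X) = - X"
    and g_add [simp]: "X \<in> V \<Longrightarrow> Y \<in> V \<Longrightarrow> Z \<in> V \<Longrightarrow> g (X + Y) Z p = g X Z p + g Y Z p"
    and g_sym: "X \<in> V \<Longrightarrow> Y \<in> V \<Longrightarrow> g X Y p = g Y X p"
    and g_J_J: "X \<in> V \<Longrightarrow> Y \<in> V \<Longrightarrow> g (J X) (J Y) p = g X Y p"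
    and g_nondegenerate: "X \<in> V \<Longrightarrow> (\<And>Y p. Y \<in> V \<Longrightarrow> g X Y p = 0) \<Longrightarrow> X = 0"
    and D_add1 [simp]: "X \<in> V \<Longrightarrow> Y \<in> V \<Longrightarrow> Z \<in> V \<Longrightarrow> D (X + Y) Z = D X Z + D Y Z"
    and D_add2 [simp]: "X \<in> V \<Longrightarrow> Y \<in> V \<Longrightarrow> Z \<in> V \<Longrightarrow> D X (Y + Z) = D X Y + D X Z"
    and E_add1 [simp]: "X \<in> V \<Longrightarrow> Y \<in> V \<Longrightarrow> Z \<in> V \<Longrightarrow> E (X + Y) Z = E X Z + E Y Z"
    and E_add2 [simp]: "X \<in> V \<Longrightarrow> Y \<in> V \<Longrightarrow> Z \<in> V \<Longrightarrow> E X (Y + Z) = E X Y + E X Z"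
    and L_D: "X \<in> V \<Longrightarrow> Y \<in> V \<Longrightarrow> Z \<in> V \<Longrightarrow> L X (g Y Z) p = g (D X Y) Z p + g Y (D X Z) p"
    and L_E: "X \<in> V \<Longrightarrow> Y \<in> V \<Longrightarrow> Z \<in> V \<Longrightarrow> L X (g Y Z) p = g (E X Y) Z p + g Y (E X Z) p"
    and br_D: "X \<in> V \<Longrightarrow> Y \<in> V \<Longrightarrow> br X Y = D X Y - D Y X"
    and jacobi: "X \<in> V \<Longrightarrow> Y \<in> V \<Longrightarrow> Z \<in> V \<Longrightarrow>
      br X (br Y Z) + br Y (br Z X) + br Z (br X Y) = 0"
    and E_J [simp]: "X \<in> V \<Longrightarrow> Y \<in> V \<Longrightarrow> E X (J Y) = J (E X Y)"
begin

section \<open>Closure of \<open>V\<close> and additivity of the operations\<close>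

text \<open>Negation in \<open>V\<close> is \<open>J\<close> applied twice, and zero is
  \<open>X + J (J X)\<close>; the premise provides some element to start from.\<close>

lemma zero_V [simp]: "X \<in> V \<Longrightarrow> 0 \<in> V"
  by (metis J_J J_V add_V add.right_inverse)

lemma uminus_V [simp]: "X \<in> V \<Longrightarrow> - X \<in> V"
  by (metis J_J J_V)

lemma diff_V [simp]: "X \<in> V \<Longrightarrow> Y \<in> V \<Longrightarrow> X - Y \<in> V"
  using add_V[of X "- Y"] by simp

lemma additive_minus:
  assumes "\<And>X Y. X \<in> V \<Longrightarrow> Y \<in> V \<Longrightarrow> f (X + Y) = f X + f Y" "X \<in> V"
  shows "f (- X) = - (f X :: 'w::ab_group_add)"
proof -
  have "f 0 + f 0 = f 0" using assms(1)[of 0 0] assms(2) by simp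
  then show ?thesis using assms(1)[of X "- X"] assms(2) by (simp add: eq_neg_iff_add_eq_0 add.commute)
qed

lemma additive_diff:
  assumes "\<And>X Y. X \<in> V \<Longrightarrow> Y \<in> V \<Longrightarrow> f (X + Y) = f X + f Y" "X \<in> V" "Y \<in> V"
  shows "f (X - Y) = f X - (f Y :: 'w::ab_group_add)"
  using assms(1)[of X "- Y"] additive_minus[of f Y] assms by simp

lemma J_minus [simp]: "X \<in> V \<Longrightarrow> J (- X) = - J X"
  by (rule additive_minus) auto

lemma J_diff [simp]: "X \<in> V \<Longrightarrow> Y \<in> V \<Longrightarrow> J (X - Y) = J X - J Y"
  by (rule additive_diff) auto

lemma D_minus1 [simp]: "X \<in> V \<Longrightarrow> Y \<in> V \<Longrightarrow> D (- X) Y = - D X Y"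
  by (rule additive_minus[of "\<lambda>X. D X Y"]) auto
lemma D_minus2 [simp]: "X \<in> V \<Longrightarrow> Y \<in> V \<Longrightarrow> D X (- Y) = - D X Y"
  by (rule additive_minus) auto
lemma D_diff1 [simp]: "X \<in> V \<Longrightarrow> Y \<in> V \<Longrightarrow> Z \<in> V \<Longrightarrow> D (X - Y) Z = D X Z - D Y Z"
  by (rule additive_diff[of "\<lambda>X. D X Z"]) auto
lemma D_diff2 [simp]: "X \<in> V \<Longrightarrow> Y \<in> V \<Longrightarrow> Z \<in> V \<Longrightarrow> D Z (X - Y) = D Z X - D Z Y"
  by (rule additive_diff) auto

lemma E_minus1 [simp]: "X \<in> V \<Longrightarrow> Y \<in> V \<Longrightarrow> E (- X) Y = - E X Y"
  by (rule additive_minus[of "\<lambda>X. E X Y"]) auto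
lemma E_minus2 [simp]: "X \<in> V \<Longrightarrow> Y \<in> V \<Longrightarrow> E X (- Y) = - E X Y"
  by (rule additive_minus) auto
lemma E_diff1 [simp]: "X \<in> V \<Longrightarrow> Y \<in> V \<Longrightarrow> Z \<in> V \<Longrightarrow> E (X - Y) Z = E X Z - E Y Z"
  by (rule additive_diff[of "\<lambda>X. E X Z"]) auto
lemma E_diff2 [simp]: "X \<in> V \<Longrightarrow> Y \<in> V \<Longrightarrow> Z \<in> V \<Longrightarrow> E Z (X - Y) = E Z X - E Z Y"
  by (rule additive_diff) auto

lemma g_minus1 [simp]: "X \<in> V \<Longrightarrow> Y \<in> V \<Longrightarrow> g (- X) Y p = - g X Y p"
  by (rule additive_minus[of "\<lambda>X. g X Y p"]) auto
lemma g_diff1 [simp]: "X \<in> V \<Longrightarrow> Y \<in> V \<Longrightarrow> Z \<in> V \<Longrightarrow> g (X - Y) Z p = g X Z p - g Y Z p"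
  by (rule additive_diff[of "\<lambda>X. g X Z p"]) auto
lemma g_minus2 [simp]: "X \<in> V \<Longrightarrow> Y \<in> V \<Longrightarrow> g X (- Y) p = - g X Y p"
  by (simp add: g_sym[of X])
lemma g_zero1 [simp]: "X \<in> V \<Longrightarrow> g 0 X p = 0"
  using g_add[of 0 0 X p] by simp

text \<open>As a rewrite rule this clears \<open>J\<close> from the first argument of
  \<open>g\<close>, so that pairings reach a normal form which linear arithmetic can
  compare.\<close>

lemma g_J1 [simp]: "X \<in> V \<Longrightarrow> Y \<in> V \<Longrightarrow> g (J X) Y p = - g X (J Y) p"
  using g_J_J[of X "J Y" p] by simp

lemma g_eqI:
  assumes "X \<in> V" "Y \<in> V" "\<And>W p. W \<in> V \<Longrightarrow> g X W p = g Y W p"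
  shows "X = Y"
  using g_nondegenerate[of "X - Y"] assms by simp

section \<open>Difference tensor, torsion and curvatures of the two connections\<close>

definition C :: "'v \<Rightarrow> 'v \<Rightarrow> 'v" where "C X Y = D X Y - E X Y"
definition T :: "'v \<Rightarrow> 'v \<Rightarrow> 'v" where "T X Y = E X Y - E Y X - br X Y"
definition R :: "'v \<Rightarrow> 'v \<Rightarrow> 'v \<Rightarrow> 'v" where
  "R X Y Z = D X (D Y Z) - D Y (D X Z) - D (br X Y) Z"
definition K :: "'v \<Rightarrow> 'v \<Rightarrow> 'v \<Rightarrow> 'v" where
  "K X Y Z = E X (E Y Z) - E Y (E X Z) - E (br X Y) Z"
definition EC :: "'v \<Rightarrow> 'v \<Rightarrow> 'v \<Rightarrow> 'v" where
  "EC X Y Z = E X (C Y Z) - C (E X Y) Z - C Y (E X Z)"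
definition ET :: "'v \<Rightarrow> 'v \<Rightarrow> 'v \<Rightarrow> 'v" where
  "ET X Y Z = E X (T Y Z) - T (E X Y) Z - T Y (E X Z)"

lemma br_V [simp]: "X \<in> V \<Longrightarrow> Y \<in> V \<Longrightarrow> br X Y \<in> V"
  by (simp add: br_D)
lemma C_V [simp]: "X \<in> V \<Longrightarrow> Y \<in> V \<Longrightarrow> C X Y \<in> V"
  by (simp add: C_def)
lemma T_V [simp]: "X \<in> V \<Longrightarrow> Y \<in> V \<Longrightarrow> T X Y \<in> V"
  by (simp add: T_def)
lemma K_V [simp]: "X \<in> V \<Longrightarrow> Y \<in> V \<Longrightarrow> Z \<in> V \<Longrightarrow> K X Y Z \<in> V"
  by (simp add: K_def)
lemma EC_V [simp]: "X \<in> V \<Longrightarrow> Y \<in> V \<Longrightarrow> Z \<in> V \<Longrightarrow> EC X Y Z \<in> V"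
  by (simp add: EC_def)
lemma ET_V [simp]: "X \<in> V \<Longrightarrow> Y \<in> V \<Longrightarrow> Z \<in> V \<Longrightarrow> ET X Y Z \<in> V"
  by (simp add: ET_def)

lemma T_C: "X \<in> V \<Longrightarrow> Y \<in> V \<Longrightarrow> T X Y = C Y X - C X Y"
  by (simp add: T_def C_def br_D)

lemma C_add [simp]:
  "X \<in> V \<Longrightarrow> Y \<in> V \<Longrightarrow> Z \<in> V \<Longrightarrow> C (X + Y) Z = C X Z + C Y Z"
  "X \<in> V \<Longrightarrow> Y \<in> V \<Longrightarrow> Z \<in> V \<Longrightarrow> C X (Y + Z) = C X Y + C X Z"
  by (simp_all add: C_def)
lemma C_diff [simp]:
  "X \<in> V \<Longrightarrow> Y \<in> V \<Longrightarrow> Z \<in> V \<Longrightarrow> C (X - Y) Z = C X Z - C Y Z"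
  "X \<in> V \<Longrightarrow> Y \<in> V \<Longrightarrow> Z \<in> V \<Longrightarrow> C X (Y - Z) = C X Y - C X Z"
  by (simp_all add: C_def)
lemma C_minus [simp]:
  "X \<in> V \<Longrightarrow> Y \<in> V \<Longrightarrow> C (- X) Y = - C X Y"
  "X \<in> V \<Longrightarrow> Y \<in> V \<Longrightarrow> C X (- Y) = - C X Y"
  by (simp_all add: C_def)

lemma T_add [simp]:
  "X \<in> V \<Longrightarrow> Y \<in> V \<Longrightarrow> Z \<in> V \<Longrightarrow> T (X + Y) Z = T X Z + T Y Z"
  "X \<in> V \<Longrightarrow> Y \<in> V \<Longrightarrow> Z \<in> V \<Longrightarrow> T X (Y + Z) = T X Y + T X Z"
  by (simp_all add: T_C)
lemma T_diff [simp]: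
  "X \<in> V \<Longrightarrow> Y \<in> V \<Longrightarrow> Z \<in> V \<Longrightarrow> T (X - Y) Z = T X Z - T Y Z"
  "X \<in> V \<Longrightarrow> Y \<in> V \<Longrightarrow> Z \<in> V \<Longrightarrow> T X (Y - Z) = T X Y - T X Z"
  by (simp_all add: T_C)
lemma T_minus [simp]:
  "X \<in> V \<Longrightarrow> Y \<in> V \<Longrightarrow> T (- X) Y = - T X Y"
  "X \<in> V \<Longrightarrow> Y \<in> V \<Longrightarrow> T X (- Y) = - T X Y"
  by (simp_all add: T_C)

lemma T_zero: "X \<in> V \<Longrightarrow> T 0 0 = 0"
  using T_diff(1)[of X X 0] by simp

lemma T_skew: "X \<in> V \<Longrightarrow> Y \<in> V \<Longrightarrow> T Y X = - T X Y"
  by (simp add: T_C)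

text \<open>Substitute \<open>D = E + C\<close> in the curvature; the bracket, written through
  \<open>E\<close> and \<open>T\<close>, contributes the term with \<open>T\<close>.\<close>

lemma R_decomp:
  assumes "X \<in> V" "Y \<in> V" "Z \<in> V"
  shows "R X Y Z = K X Y Z + EC X Y Z - EC Y X Z + C (T X Y) Z + C X (C Y Z) - C Y (C X Z)"
proof -
  have 1: "D U W = E U W + C U W" for U W by (simp add: C_def)
  have 2: "br X Y = E X Y - E Y X - T X Y" by (simp add: T_def)
  show ?thesis using assms
    by (simp add: R_def K_def EC_def 1 2 algebra_simps)
qed

text \<open>Once brackets are written through \<open>E\<close> and \<open>T\<close>, the two sides
  differ by a cyclic sum of double brackets, which the Jacobi identity removes.\<close>

lemma bianchi_torsion:
  assumes "X \<in> V" "Y \<in> V" "Z \<in> V"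
  shows "K X Y Z + K Y Z X + K Z X Y =
    ET X Y Z + ET Y Z X + ET Z X Y + T (T X Y) Z + T (T Y Z) X + T (T Z X) Y"
proof -
  have 2: "br U W = E U W - E W U - T U W" for U W by (simp add: T_def)
  show ?thesis using assms jacobi[OF assms]
    \<comment> \<open>The instances of \<open>T_skew\<close> move a nested \<open>E\<close> or
      \<open>T\<close> into the first argument of \<open>T\<close>, so that equal terms agree
      syntactically.\<close>
    by (simp add: K_def ET_def 2 T_skew[of "E _ _"] T_skew[of "T _ _"] algebra_simps)
qed

section \<open>The exterior derivative of the fundamental form\<close>

definition dw :: "'v \<Rightarrow> 'v \<Rightarrow> 'v \<Rightarrow> 'p \<Rightarrow> real" where
  "dw X Y Z p = L X (g (J Y) Z) p - L Y (g (J X) Z) p + L Z (g (J X) Y) p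
    - g (J (br X Y)) Z p + g (J (br X Z)) Y p - g (J (br Y Z)) X p"

text \<open>Since \<open>D\<close> is metric and torsion-free, the invariant formula for the
  differential collapses to derivatives of \<open>J\<close>: \<open>D X (J Y) - J (D X Y)\<close> is
  the derivative of \<open>J\<close> along \<open>X\<close>, applied to \<open>Y\<close>.\<close>

lemma dw_cyclic:
  assumes "X \<in> V" "Y \<in> V" "Z \<in> V"
  shows "dw X Y Z p = g (D X (J Y) - J (D X Y)) Z p + g (D Y (J Z) - J (D Y Z)) X p
    + g (D Z (J X) - J (D Z X)) Y p"
proof -
  \<comment> \<open>\<open>J\<close> is moved onto \<open>Z\<close> before \<open>L Y\<close> is
    expanded, so that \<open>D Y (J Z)\<close> appears.\<close>
  have "g (J X) Z = g (- X) (J Z)"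
    using assms by (simp add: fun_eq_iff)
  then have "L Y (g (J X) Z) p = L Y (g (- X) (J Z)) p" by simp
  then show ?thesis
    using assms g_sym[of "D _ _" X p] g_sym[of "D _ _" Y p] g_sym[of "D _ _" "J X" p]
      g_sym[of "D _ _" "J Y" p]
    by (simp add: dw_def L_D br_D)
qed

lemma dw_minus:
  assumes "X \<in> V" "Y \<in> V" "Z \<in> V"
  shows "dw (- X) Y Z p = - dw X Y Z p" "dw X (- Y) Z p = - dw X Y Z p"
  using assms by (simp_all add: dw_cyclic)

lemma dw_zero:
  assumes "X \<in> V" "Y \<in> V"
  shows "dw 0 X Y p = 0" "dw X 0 Y p = 0"
  using dw_minus[of 0 X Y p] dw_minus[of X 0 Y p] assms by simp_all

end

section \<open>Types of the difference tensor and the torsion\<close>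

text \<open>\<open>torsion_J_J\<close> encodes the vanishing (1,1)-part of the torsion, and
  \<open>dw_12\<close> is the real part of the differential at \<open>X - \<i> J X\<close>,
  \<open>Y + \<i> J Y\<close>, \<open>Z + \<i> J Z\<close>. \<open>double_zero\<close> excludes
  elements of order two from the abstract group.\<close>

locale quasi_kaehler_pair = almost_hermitian_pair +
  assumes torsion_J_J: "X \<in> V \<Longrightarrow> Y \<in> V \<Longrightarrow> T (J X) (J Y) = - T X Y"
    and dw_12: "X \<in> V \<Longrightarrow> Y \<in> V \<Longrightarrow> Z \<in> V \<Longrightarrow>
      dw X Y Z p + dw (J X) (J Y) Z p + dw (J X) Y (J Z) p - dw X (J Y) (J Z) p = 0"
    and double_zero: "x + x = 0 \<Longrightarrow> x = (0::'a)"
begin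

lemma C_skew: "X \<in> V \<Longrightarrow> Y \<in> V \<Longrightarrow> Z \<in> V \<Longrightarrow> g (C X Y) Z p = - g (C X Z) Y p"
  using L_D[of X Y Z p] L_E[of X Y Z p] by (simp add: C_def g_sym[of Y])

text \<open>In \<open>dw_12\<close>, expanded by \<open>dw_cyclic\<close>, the derivatives along
  \<open>Y\<close>, \<open>Z\<close>, \<open>J Y\<close> and \<open>J Z\<close> cancel, because a
  derivative of \<open>J\<close> anticommutes with \<open>J\<close>. What remains is twice the
  claim, paired with \<open>Z\<close>.\<close>

lemma D_J_J:
  assumes "X \<in> V" "Y \<in> V"
  shows "D (J X) (J (J Y)) - J (D (J X) (J Y)) = - (D X (J Y) - J (D X Y))"
proof (rule g_eqI)
  fix Z p assume "Z \<in> V"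
  then show "g (D (J X) (J (J Y)) - J (D (J X) (J Y))) Z p = g (- (D X (J Y) - J (D X Y))) Z p"
    using dw_12[of X Y Z p] assms by (simp add: dw_cyclic)
qed (use assms in simp_all)

lemma double_eq_zero: "X \<in> V \<Longrightarrow> X = - X \<Longrightarrow> X = 0"
  by (metis double_zero add.right_inverse)

lemma double_cancel: "X \<in> V \<Longrightarrow> Y \<in> V \<Longrightarrow> X + X = Y + Y \<Longrightarrow> X = Y"
  using double_zero[of "X - Y"] by (simp add: algebra_simps)

text \<open>
  \<open>S\<close> is twice the difference between \<open>D - 1/2 J DJ\<close> and \<open>E\<close>: the argument is the uniqueness of the
  canonical connection.
\<close>

lemma C_J2 [simp]:
  assumes "X \<in> V" "Y \<in> V"
  shows "C X (J Y) = - J (C X Y)"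
proof -
  define S where "S X Y = C X Y - J (C X (J Y))" for X Y
  \<comment> \<open>\<open>P\<close> is twice the part of \<open>S\<close> that is antilinear in
    \<open>X\<close>. The torsion condition makes \<open>P\<close> symmetric; being linear in one
    argument and antilinear in the other, it vanishes.\<close>
  define P where "P X Y = S X Y + S (J X) (J Y)" for X Y
  have SV [simp]: "S X Y \<in> V" if "X \<in> V" "Y \<in> V" for X Y using that by (simp add: S_def)
  have PV [simp]: "P X Y \<in> V" if "X \<in> V" "Y \<in> V" for X Y using that by (simp add: P_def)
  have S2 [simp]: "S X (J Y) = J (S X Y)" if "X \<in> V" "Y \<in> V" for X Y using that by (simp add: S_def)
  have Sm [simp]: "S (- X) Y = - S X Y" "S X (- Y) = - S X Y" if "X \<in> V" "Y \<in> V" for X Y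
    using that by (simp_all add: S_def)
  have b: "C (J X) Y + J (C (J X) (J Y)) = C X (J Y) - J (C X Y)" if "X \<in> V" "Y \<in> V" for X Y
    using D_J_J[OF that] that by (simp add: C_def algebra_simps)
  have "P X Y = (C X Y + C (J X) (J Y)) + (C X Y + C (J X) (J Y))" if "X \<in> V" "Y \<in> V" for X Y
  proof -
    have "J (C (J X) Y) = C (J X) (J Y) + C X Y + J (C X (J Y))"
      using arg_cong[OF b[OF that], of J] that by (simp add: algebra_simps)
    then show ?thesis using that by (simp add: P_def S_def algebra_simps)
  qed
  moreover have "C X Y + C (J X) (J Y) = C Y X + C (J Y) (J X)" if "X \<in> V" "Y \<in> V" for X Y
    using torsion_J_J[OF that] that by (simp add: T_C algebra_simps)
  ultimately have P_sym: "P X Y = P Y X" if "X \<in> V" "Y \<in> V" for X Y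
    using that by simp
  have P2: "P X (J Y) = J (P X Y)" if "X \<in> V" "Y \<in> V" for X Y
    using that by (simp add: P_def)
  have P1: "P (J X) Y = - J (P X Y)" if "X \<in> V" "Y \<in> V" for X Y
    using that by (simp add: P_def algebra_simps)
  have "J (P X Y) = 0" if "X \<in> V" "Y \<in> V" for X Y
  proof (rule double_eq_zero)
    show "J (P X Y) = - J (P X Y)"
      using P1[OF that] P2[of Y X] P_sym[of Y X] P_sym[of Y "J X"] that by simp
  qed (use that in simp)
  then have S1: "S (J X) Y = J (S X Y)" if "X \<in> V" "Y \<in> V" for X Y
    using that by (simp add: P_def algebra_simps)
  have S_skew: "g (S X Y) Z p = - g (S X Z) Y p" if "X \<in> V" "Y \<in> V" "Z \<in> V" for X Y Z p
    using that C_skew[of X Y Z p] C_skew[of X "J Y" "J Z" p] by (simp add: S_def)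
  \<comment> \<open>\<open>S (J X)\<close> is skew for \<open>g\<close>, but it also equals
    \<open>J\<close> composed with \<open>S X\<close>, a product of commuting skew maps and hence
    symmetric.\<close>
  have "S (J X) Y = 0" if "X \<in> V" "Y \<in> V" for X Y
  proof (rule g_nondegenerate)
    fix Z p assume "Z \<in> V"
    then show "g (S (J X) Y) Z p = 0"
      using that S_skew[of X Y "J Z" p] S_skew[of "J X" Y Z p] by (simp add: S1)
  qed (use that in simp)
  from this[of "J X" Y] have "S X Y = 0" using assms by simp
  then have "C X Y = J (C X (J Y))" by (simp add: S_def)
  then show ?thesis using assms by simp
qed

text \<open>By \<open>C_J2\<close> the derivative of \<open>J\<close> along \<open>X\<close> at
  \<open>Y\<close> is twice \<open>- J (C X Y)\<close>, so \<open>D_J_J\<close> becomes a statement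
  about \<open>C\<close> alone.\<close>

lemma C_J1 [simp]:
  assumes "X \<in> V" "Y \<in> V"
  shows "C (J X) Y = - J (C X Y)"
proof (rule double_cancel)
  have "D X (J Y) - J (D X Y) = C X (J Y) - J (C X Y)" if "X \<in> V" "Y \<in> V" for X Y
    using that by (simp add: C_def)
  from this[of X Y] this[of "J X" "J Y"] D_J_J[OF assms]
  have "- (C (J X) Y + C (J X) Y) = J (C X Y) + J (C X Y)"
    using assms by simp
  then show "C (J X) Y + C (J X) Y = - J (C X Y) + - J (C X Y)"
    by (metis minus_add_distrib minus_minus)
qed (use assms in simp_all)

lemma T_J [simp]:
  "X \<in> V \<Longrightarrow> Y \<in> V \<Longrightarrow> T (J X) Y = - J (T X Y)"
  "X \<in> V \<Longrightarrow> Y \<in> V \<Longrightarrow> T X (J Y) = - J (T X Y)"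
  by (simp_all add: T_C)

lemma K_J [simp]: "X \<in> V \<Longrightarrow> Y \<in> V \<Longrightarrow> Z \<in> V \<Longrightarrow> K X Y (J Z) = J (K X Y Z)"
  by (simp add: K_def)
lemma EC_J [simp]:
  "X \<in> V \<Longrightarrow> Y \<in> V \<Longrightarrow> Z \<in> V \<Longrightarrow> EC X (J Y) Z = - J (EC X Y Z)"
  "X \<in> V \<Longrightarrow> Y \<in> V \<Longrightarrow> Z \<in> V \<Longrightarrow> EC X Y (J Z) = - J (EC X Y Z)"
  by (simp_all add: EC_def)
lemma ET_J [simp]:
  "X \<in> V \<Longrightarrow> Y \<in> V \<Longrightarrow> Z \<in> V \<Longrightarrow> ET X (J Y) Z = - J (ET X Y Z)"
  "X \<in> V \<Longrightarrow> Y \<in> V \<Longrightarrow> Z \<in> V \<Longrightarrow> ET X Y (J Z) = - J (ET X Y Z)"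
  by (simp_all add: ET_def)

lemma br_minus [simp]:
  "X \<in> V \<Longrightarrow> Y \<in> V \<Longrightarrow> br (- X) Y = - br X Y"
  "X \<in> V \<Longrightarrow> Y \<in> V \<Longrightarrow> br X (- Y) = - br X Y"
  by (simp_all add: br_D)

lemma K_minus [simp]:
  "X \<in> V \<Longrightarrow> Y \<in> V \<Longrightarrow> Z \<in> V \<Longrightarrow> K (- X) Y Z = - K X Y Z"
  "X \<in> V \<Longrightarrow> Y \<in> V \<Longrightarrow> Z \<in> V \<Longrightarrow> K X (- Y) Z = - K X Y Z"
  "X \<in> V \<Longrightarrow> Y \<in> V \<Longrightarrow> Z \<in> V \<Longrightarrow> K X Y (- Z) = - K X Y Z"
  by (simp_all add: K_def)
lemma EC_minus [simp]:
  "X \<in> V \<Longrightarrow> Y \<in> V \<Longrightarrow> Z \<in> V \<Longrightarrow> EC (- X) Y Z = - EC X Y Z"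
  "X \<in> V \<Longrightarrow> Y \<in> V \<Longrightarrow> Z \<in> V \<Longrightarrow> EC X (- Y) Z = - EC X Y Z"
  "X \<in> V \<Longrightarrow> Y \<in> V \<Longrightarrow> Z \<in> V \<Longrightarrow> EC X Y (- Z) = - EC X Y Z"
  by (simp_all add: EC_def)
lemma ET_minus [simp]:
  "X \<in> V \<Longrightarrow> Y \<in> V \<Longrightarrow> Z \<in> V \<Longrightarrow> ET (- X) Y Z = - ET X Y Z"
  "X \<in> V \<Longrightarrow> Y \<in> V \<Longrightarrow> Z \<in> V \<Longrightarrow> ET X (- Y) Z = - ET X Y Z"
  "X \<in> V \<Longrightarrow> Y \<in> V \<Longrightarrow> Z \<in> V \<Longrightarrow> ET X Y (- Z) = - ET X Y Z"
  by (simp_all add: ET_def)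

section \<open>Derivatives of the torsion and the first Bianchi identity\<close>

lemma ET_EC: "X \<in> V \<Longrightarrow> Y \<in> V \<Longrightarrow> Z \<in> V \<Longrightarrow> ET X Y Z = EC X Z Y - EC X Y Z"
  by (simp add: ET_def EC_def T_C algebra_simps)

text \<open>Differentiate \<open>C_skew\<close> along the metric connection
  \<open>E\<close>.\<close>

lemma EC_skew:
  assumes "X \<in> V" "Y \<in> V" "Z \<in> V" "W \<in> V"
  shows "g (EC X Y Z) W p = - g (EC X Y W) Z p"
proof -
  have "g (C Y Z) W = g (- C Y W) Z"
    using C_skew[of Y Z W] assms by (simp add: fun_eq_iff)
  then have "L X (g (C Y Z) W) p = L X (g (- C Y W) Z) p" by simp
  then have "g (E X (C Y Z)) W p + g (C Y Z) (E X W) p = - g (E X (C Y W)) Z p - g (C Y W) (E X Z) p"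
    using assms by (simp add: L_E)
  then show ?thesis
    using assms C_skew[of "E X Y" Z W p] C_skew[of Y "E X Z" W p] C_skew[of Y Z "E X W" p]
    by (simp add: EC_def)
qed

text \<open>The Koszul trick: a tensor that is skew in its last two slots is recovered from its
  antisymmetrisation in the first two; here \<open>X\<close> is a parameter.\<close>

lemma EC_from_ET:
  assumes "X \<in> V" "Y \<in> V" "Z \<in> V" "W \<in> V"
  shows "2 * g (EC X Y Z) W p = - g (ET X Y Z) W p + g (ET X Z W) Y p - g (ET X W Y) Z p"
  using assms EC_skew[of X Y Z W p] EC_skew[of X Z Y W p] EC_skew[of X W Y Z p]
  by (simp add: ET_EC)

lemma EC_iff_ET:
  "(\<forall>X\<in>V. \<forall>Y\<in>V. \<forall>Z\<in>V. EC (J X) Y Z = - J (EC X Y Z)) \<longleftrightarrow>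
   (\<forall>X\<in>V. \<forall>Y\<in>V. \<forall>Z\<in>V. ET (J X) Y Z = - J (ET X Y Z))"
proof (intro iffI ballI)
  fix X Y Z assume *: "\<forall>X\<in>V. \<forall>Y\<in>V. \<forall>Z\<in>V. EC (J X) Y Z = - J (EC X Y Z)" "X \<in> V" "Y \<in> V" "Z \<in> V"
  then show "ET (J X) Y Z = - J (ET X Y Z)" by (simp add: ET_EC)
next
  fix X Y Z assume *: "\<forall>X\<in>V. \<forall>Y\<in>V. \<forall>Z\<in>V. ET (J X) Y Z = - J (ET X Y Z)" "X \<in> V" "Y \<in> V" "Z \<in> V"
  show "EC (J X) Y Z = - J (EC X Y Z)"
  proof (rule g_eqI)
    fix W p assume "W \<in> V"
    then show "g (EC (J X) Y Z) W p = g (- J (EC X Y Z)) W p"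
      using * EC_from_ET[of "J X" Y Z W p] EC_from_ET[of X Y Z "J W" p] by simp
  qed (use * in simp_all)
qed

text \<open>
  The cyclic sum of \<open>ET\<close> is of type (3,0) + (0,3) in its arguments, while each of the three
  terms of the cyclic sum of \<open>K\<close> commutes with \<open>J\<close> in one argument and so has no such component.
\<close>

lemma K_cyclic_eq_0:
  assumes P: "\<And>X Y Z. X \<in> V \<Longrightarrow> Y \<in> V \<Longrightarrow> Z \<in> V \<Longrightarrow> ET (J X) Y Z = - J (ET X Y Z)"
    and Q: "\<And>X Y Z. X \<in> V \<Longrightarrow> Y \<in> V \<Longrightarrow> Z \<in> V \<Longrightarrow> T (T X Y) Z = 0"
    and XYZ: "X \<in> V" "Y \<in> V" "Z \<in> V"
  shows "K X Y Z + K Y Z X + K Z X Y = 0"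
proof -
  define U where "U X Y Z = K X Y Z + K Y Z X + K Z X Y" for X Y Z
  have UV [simp]: "U X Y Z \<in> V" if "X \<in> V" "Y \<in> V" "Z \<in> V" for X Y Z
    using that by (simp add: U_def)
  have U: "U X Y Z = ET X Y Z + ET Y Z X + ET Z X Y" if "X \<in> V" "Y \<in> V" "Z \<in> V" for X Y Z
    using that by (simp add: U_def bianchi_torsion Q)
  have UJ: "U (J X) Y Z = - J (U X Y Z)" "U X (J Y) Z = - J (U X Y Z)" "U X Y (J Z) = - J (U X Y Z)"
    if "X \<in> V" "Y \<in> V" "Z \<in> V" for X Y Z
    using that by (simp_all add: U P algebra_simps)
  have "U X Y Z = 0"
  proof (rule g_nondegenerate)
    fix W p assume W: "W \<in> V"
    \<comment> \<open>The combination is eight times the projection to the part antilinear in all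
      three arguments. It multiplies \<open>U\<close> by 8, while each \<open>K\<close> term, linear
      in one argument, cancels in pairs.\<close>
    have "8 * g (U X Y Z) W p =
      g (U X Y Z + J (U (J X) Y Z) + J (U X (J Y) Z) + J (U X Y (J Z))
        - U (J X) (J Y) Z - U (J X) Y (J Z) - U X (J Y) (J Z) - J (U (J X) (J Y) (J Z))) W p"
      using XYZ W by (simp add: UJ)
    also have "\<dots> = 0"
      using XYZ W by (simp add: U_def)
    finally show "g (U X Y Z) W p = 0" by simp
  qed (use XYZ in simp)
  then show ?thesis by (simp add: U_def)
qed

lemma bianchi_iff:
  "(\<forall>X\<in>V. \<forall>Y\<in>V. \<forall>Z\<in>V. K X Y Z + K Y Z X + K Z X Y = 0) \<longleftrightarrow>
   (\<forall>X\<in>V. \<forall>Y\<in>V. \<forall>Z\<in>V. ET (J X) Y Z = - J (ET X Y Z)) \<and>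
   (\<forall>X\<in>V. \<forall>Y\<in>V. \<forall>Z\<in>V. T (T X Y) Z = 0)"
proof (intro iffI conjI ballI)
  fix X Y Z assume XYZ: "X \<in> V" "Y \<in> V" "Z \<in> V"
    and *: "\<forall>X\<in>V. \<forall>Y\<in>V. \<forall>Z\<in>V. K X Y Z + K Y Z X + K Z X Y = 0"
  have S: "g (ET X Y Z + ET Y Z X + ET Z X Y + T (T X Y) Z + T (T Y Z) X + T (T Z X) Y) W p = 0"
    if "X \<in> V" "Y \<in> V" "Z \<in> V" "W \<in> V" for X Y Z W p
    using that * bianchi_torsion[of X Y Z] by simp
  \<comment> \<open>The eight instances separate the types, which are distinct for the six terms of the sum
    (up to the part of \<open>ET\<close> that is of type (3,0) + (0,3)).\<close>
  note S8 = S[of X Y Z] S[of "J X" Y Z] S[of X "J Y" Z] S[of X Y "J Z"]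
    S[of "J X" "J Y" Z] S[of "J X" Y "J Z"] S[of X "J Y" "J Z"] S[of "J X" "J Y" "J Z"]
  show "ET (J X) Y Z = - J (ET X Y Z)"
  proof (rule g_eqI)
    fix W p assume W: "W \<in> V"
    \<comment> \<open>Pairing with \<open>J W\<close> as well closes the relations under
      \<open>J\<close>; the goal is then a linear consequence of these instances.\<close>
    note S8[of W p] S8[of "J W" p]
    then show "g (ET (J X) Y Z) W p = g (- J (ET X Y Z)) W p"
      using XYZ W by simp
  qed (use XYZ in simp_all)
  show "T (T X Y) Z = 0"
  proof (rule g_nondegenerate)
    fix W p assume W: "W \<in> V"
    note S8[of W p] S8[of "J W" p]
    then show "g (T (T X Y) Z) W p = 0"
      using XYZ W by simp
  qed (use XYZ in simp)
qed (use K_cyclic_eq_0 in blast)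

section \<open>The Nijenhuis tensor and the two curvature conditions\<close>

definition N :: "'a \<Rightarrow> 'a \<Rightarrow> 'a" where
  "N X Y = br (J X) (J Y) - J (br (J X) Y) - J (br X (J Y)) - br X Y"

text \<open>The \<open>E\<close> terms cancel because \<open>J\<close> is parallel for
  \<open>E\<close>, and each of the four brackets contributes one \<open>T X Y\<close>. The multiple
  is written as a sum because fields form only an abelian group here.\<close>

lemma N_T:
  assumes "X \<in> V" "Y \<in> V"
  shows "N X Y = T X Y + T X Y + (T X Y + T X Y)"
proof -
  have br: "br U W = E U W - E W U - T U W" for U W by (simp add: T_def)
  show ?thesis using assms by (simp add: N_def br algebra_simps)
qed

definition DN :: "'a \<Rightarrow> 'a \<Rightarrow> 'a \<Rightarrow> 'a" where
  "DN X Y Z = D X (N Y Z) - N (D X Y) Z - N Y (D X Z)"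

lemma DN_decomp:
  assumes "X \<in> V" "Y \<in> V" "Z \<in> V" "W \<in> V"
  shows "g (DN X Y Z) W p =
    4 * (g (ET X Y Z) W p + g (C X (T Y Z)) W p - g (T (C X Y) Z) W p - g (T Y (C X Z)) W p)"
proof -
  have "D U W = E U W + C U W" for U W by (simp add: C_def)
  then show ?thesis using assms by (simp add: DN_def N_T ET_def)
qed

text \<open>
  Complex-linear extension evaluated at \<open>X - \<i> J X\<close> (\<open>c1\<close>) and at \<open>X + \<i> J X\<close> (\<open>c0\<close>), the fields of
  type (1,0) and (0,1) with real part \<open>X\<close>.
\<close>

definition c1 :: "('a \<Rightarrow> complex) \<Rightarrow> 'a \<Rightarrow> complex" where
  "c1 \<tau> X = \<tau> X + \<i> * \<tau> (- J X)"

definition c0 :: "('a \<Rightarrow> complex) \<Rightarrow> 'a \<Rightarrow> complex" where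
  "c0 \<tau> X = \<tau> X + \<i> * \<tau> (J X)"

text \<open>In \<open>R_decomp\<close> only \<open>EC X Y Z\<close> survives. \<open>C\<close> and
  \<open>T\<close> vanish on arguments of mixed type, and \<open>K X Y Z\<close> and
  \<open>C X (C Y Z)\<close> are of type (1,0), which pairs to zero with the (1,0) field from
  \<open>W\<close>.\<close>

lemma R_0111:
  assumes "X \<in> V" "Y \<in> V" "Z \<in> V" "W \<in> V"
  shows "c0 (\<lambda>X. c1 (\<lambda>Y. c1 (\<lambda>Z. c1 (\<lambda>W. complex_of_real (g (R X Y Z) W p)) W) Z) Y) X =
    4 * Complex (g (EC X Y Z) W p + g (EC (J X) Y Z) (J W) p)
      (g (EC (J X) Y Z) W p - g (EC X Y Z) (J W) p)"
  using assms by (simp add: c0_def c1_def R_decomp complex_eq_iff)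

text \<open>Here \<open>K X Y Z\<close> is of type (0,1) like \<open>W\<close>, and all other terms
  except \<open>C (T X Y) Z\<close> contain a mixed pair; \<open>T\<close> sends two (1,0) fields to
  type (0,1).\<close>

lemma R_1100:
  assumes "X \<in> V" "Y \<in> V" "Z \<in> V" "W \<in> V"
  shows "c1 (\<lambda>X. c1 (\<lambda>Y. c0 (\<lambda>Z. c0 (\<lambda>W. complex_of_real (g (R X Y Z) W p)) W) Z) Y) X =
    8 * Complex (g (C (T X Y) Z) W p) (g (C (T X Y) Z) (J W) p)"
  using assms by (simp add: c0_def c1_def R_decomp complex_eq_iff)

text \<open>The term \<open>ET X Y Z\<close> has the type (0,1) of \<open>W\<close> and
  \<open>C X\<close> kills (1,0) fields, which leaves \<open>C X (T Y Z)\<close>.\<close>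

lemma DN_0110:
  assumes "X \<in> V" "Y \<in> V" "Z \<in> V" "W \<in> V"
  shows "c0 (\<lambda>X. c1 (\<lambda>Y. c1 (\<lambda>Z. c0 (\<lambda>W. complex_of_real (g (DN X Y Z) W p)) W) Z) Y) X =
    32 * Complex (g (C X (T Y Z)) W p) (g (C X (T Y Z)) (J W) p)"
  using assms by (simp add: c0_def c1_def DN_decomp complex_eq_iff)

lemma third_gray_iff:
  "(\<forall>X\<in>V. \<forall>Y\<in>V. \<forall>Z\<in>V. \<forall>W\<in>V. \<forall>p.
      c0 (\<lambda>X. c1 (\<lambda>Y. c1 (\<lambda>Z. c1 (\<lambda>W. complex_of_real (g (R X Y Z) W p)) W) Z) Y) X = 0) \<longleftrightarrow>
   (\<forall>X\<in>V. \<forall>Y\<in>V. \<forall>Z\<in>V. EC (J X) Y Z = - J (EC X Y Z))" (is "?l \<longleftrightarrow> ?r")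
proof
  assume ?r
  then show ?l by (simp add: R_0111 complex_eq_iff)
next
  assume l: ?l
  show ?r
  proof (intro ballI)
    fix X Y Z assume XYZ: "X \<in> V" "Y \<in> V" "Z \<in> V"
    show "EC (J X) Y Z = - J (EC X Y Z)"
    proof (rule g_eqI)
      fix W p assume "W \<in> V"
      then show "g (EC (J X) Y Z) W p = g (- J (EC X Y Z)) W p"
        using l XYZ by (simp add: R_0111 complex_eq_iff)
    qed (use XYZ in simp_all)
  qed
qed

text \<open>By \<open>R_1100\<close> and \<open>DN_0110\<close> the equation compares
  \<open>C (T X Y) Z\<close> with \<open>C Z (T X Y)\<close>, and by \<open>T_C\<close> their
  difference is \<open>T (T X Y) Z\<close> up to sign.\<close>

lemma nijenhuis_deriv_iff:
  "(\<forall>X\<in>V. \<forall>Y\<in>V. \<forall>Z\<in>V. \<forall>W\<in>V. \<forall>p.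
      c1 (\<lambda>X. c1 (\<lambda>Y. c0 (\<lambda>Z. c0 (\<lambda>W. complex_of_real (g (R X Y Z) W p)) W) Z) Y) X =
      1 / 4 * c0 (\<lambda>a. c1 (\<lambda>b. c1 (\<lambda>c. c0 (\<lambda>d. complex_of_real (g (DN a b c) d p)) W) Y) X) Z) \<longleftrightarrow>
   (\<forall>X\<in>V. \<forall>Y\<in>V. \<forall>Z\<in>V. T (T X Y) Z = 0)" (is "?l \<longleftrightarrow> ?r")
proof
  assume r: ?r
  have "C (T X Y) Z = C Z (T X Y)" if "X \<in> V" "Y \<in> V" "Z \<in> V" for X Y Z
    using that r T_C[of "T X Y" Z] by simp
  then show ?l by (simp add: R_1100 DN_0110 complex_eq_iff)
next
  assume l: ?l
  show ?r
  proof (intro ballI)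
    fix X Y Z assume XYZ: "X \<in> V" "Y \<in> V" "Z \<in> V"
    show "T (T X Y) Z = 0"
    proof (rule g_nondegenerate)
      fix W p assume W: "W \<in> V"
      then have "g (C (T X Y) Z) W p = g (C Z (T X Y)) W p"
        using l XYZ by (simp add: R_1100 DN_0110 complex_eq_iff)
      then show "g (T (T X Y) Z) W p = 0"
        using XYZ W by (simp add: T_C[of "T X Y" Z])
    qed (use XYZ in simp)
  qed
qed

end

section \<open>Smooth functions, vector fields and the Jacobi identity\<close>

lemma Ck_on_cong:
  assumes "open S" "\<And>x. x \<in> S \<Longrightarrow> f x = h x" "Ck_on k S f"
  shows "Ck_on k S h"
  using assms(2,3)
proof (induction k arbitrary: f h)
  case 0
  then show ?case by (metis Ck_on.simps(1) continuous_on_cong)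
next
  case (Suc k)
  have diff: "f differentiable at x" if "x \<in> S" for x
    using Suc.prems that by simp
  have "h differentiable at x" if "x \<in> S" for x
    using diff[OF that] Suc.prems(1) assms(1) that
    by (meson differentiable_def has_derivative_transform_within_open)
  moreover have "Ck_on k S (\<lambda>x. frechet_derivative h (at x) v)" for v
  proof (rule Suc.IH)
    show "Ck_on k S (\<lambda>x. frechet_derivative f (at x) v)" using Suc.prems by simp
    show "frechet_derivative f (at x) v = frechet_derivative h (at x) v" if "x \<in> S" for x
      using frechet_derivative_transform_within_open[OF diff assms(1)] that Suc.prems(1) by metis
  qed
  ultimately show ?case by simp
qed

lemma Ck_on_add:
  assumes "open S" "Ck_on k S f" "Ck_on k S h"
  shows "Ck_on k S (\<lambda>x. f x + h x)"
  using assms(2,3)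
proof (induction k arbitrary: f h)
  case 0
  then show ?case by (simp add: continuous_on_add)
next
  case (Suc k)
  have "Ck_on k S (\<lambda>x. frechet_derivative (\<lambda>x. f x + h x) (at x) v)" for v
  proof (rule Ck_on_cong[OF assms(1)])
    show "Ck_on k S (\<lambda>x. frechet_derivative f (at x) v + frechet_derivative h (at x) v)"
      using Suc by simp
    fix x assume "x \<in> S"
    then have "((\<lambda>x. f x + h x) has_derivative
        (\<lambda>v. frechet_derivative f (at x) v + frechet_derivative h (at x) v)) (at x)"
      using Suc.prems by (intro has_derivative_add) (simp_all flip: frechet_derivative_works)
    then show "frechet_derivative f (at x) v + frechet_derivative h (at x) v =
        frechet_derivative (\<lambda>x. f x + h x) (at x) v"
      by (rule fun_cong[OF frechet_derivative_at])
  qed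
  then show ?case using Suc.prems by simp
qed

lemma smooth_fun_add:
  assumes "smooth_atlas A" "smooth_fun A f" "smooth_fun A h"
  shows "smooth_fun A (\<lambda>q. f q + h q)"
proof -
  have "smooth_on (\<phi> ` U) ((\<lambda>q. f q + h q) \<circ> inv_into U \<phi>)" if "(U, \<phi>) \<in> A" for U \<phi>
  proof -
    have "open (\<phi> ` U)"
      using assms(1) that by (auto simp: smooth_atlas_def is_chart_def)
    then show ?thesis
      using assms(2,3) that Ck_on_add[of "\<phi> ` U" _ "f \<circ> inv_into U \<phi>" "h \<circ> inv_into U \<phi>"]
      by (force simp: smooth_fun_def smooth_on_def o_def)
  qed
  then show ?thesis by (auto simp: smooth_fun_def)
qed

lemma vector_fieldsD:
  assumes "X \<in> vector_fields A"
  shows "X p \<in> tangent_space A p"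
    and "smooth_fun A f \<Longrightarrow> smooth_fun A (deriv_along X f)"
    and "smooth_fun A f \<Longrightarrow> smooth_fun A h \<Longrightarrow> X p (f + h) = X p f + X p h"
    and "\<not> smooth_fun A f \<Longrightarrow> X p f = 0"
  using assms by (auto simp: vector_fields_def tangent_space_def deriv_along_def)

lemma vector_fields_add:
  assumes "smooth_atlas A" "X \<in> vector_fields A" "Y \<in> vector_fields A"
  shows "X + Y \<in> vector_fields A"
  using assms smooth_fun_add[OF assms(1)]
  by (auto simp: vector_fields_def tangent_space_def algebra_simps)

text \<open>Closure under the bracket is a premise, to be supplied by a torsion-free connection. On
  smooth functions the triple derivatives cancel; on all others fields are 0 by convention.\<close>

lemma bracket_jacobi:
  assumes V: "\<And>X Y. X \<in> vector_fields A \<Longrightarrow> Y \<in> vector_fields A \<Longrightarrow> bracket X Y \<in> vector_fields A"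
    and XYZ: "X \<in> vector_fields A" "Y \<in> vector_fields A" "Z \<in> vector_fields A"
  shows "bracket X (bracket Y Z) + bracket Y (bracket Z X) + bracket Z (bracket X Y) = 0"
proof -
  have br: "X p (deriv_along (bracket Y Z) f) =
      X p (deriv_along Y (deriv_along Z f)) - X p (deriv_along Z (deriv_along Y f))"
    if "X \<in> vector_fields A" "Y \<in> vector_fields A" "Z \<in> vector_fields A" "smooth_fun A f"
    for X Y Z p f
  proof -
    \<comment> \<open>\<open>X p\<close> is additive on smooth functions, so the difference is first
      turned into a sum.\<close>
    have "deriv_along (bracket Y Z) f + deriv_along Z (deriv_along Y f) = deriv_along Y (deriv_along Z f)"
      by (simp add: fun_eq_iff deriv_along_def bracket_def)
    then have "X p (deriv_along (bracket Y Z) f) + X p (deriv_along Z (deriv_along Y f)) =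
        X p (deriv_along Y (deriv_along Z f))"
      using that V by (metis vector_fieldsD(2,3))
    then show ?thesis by simp
  qed
  have "(bracket X (bracket Y Z) + bracket Y (bracket Z X) + bracket Z (bracket X Y)) p f = 0" for p f
  proof (cases "smooth_fun A f")
    case True
    have *: "bracket U (bracket V W) p f = U p (deriv_along (bracket V W) f)
        - V p (deriv_along W (deriv_along U f)) + W p (deriv_along V (deriv_along U f))" for U V W
      by (simp add: bracket_def deriv_along_def)
    show ?thesis using True XYZ by (simp add: * br)
  next
    case False
    then show ?thesis using vector_fieldsD(4)[OF V[OF _ V]] XYZ by simp
  qed
  then show ?thesis by (simp add: fun_eq_iff)
qed

section \<open>Complex fields of type (1,0) and their conjugates\<close>

lemma re_im_field_cnj [simp]:
  "re_field (cnj_field Z) = re_field Z" "im_field (cnj_field Z) = - im_field Z"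
  by (simp_all add: cnj_field_def re_field_def im_field_def fun_eq_iff)

lemma re_im_field_zero [simp]: "re_field 0 = 0" "im_field 0 = 0"
  by (simp_all add: re_field_def im_field_def fun_eq_iff)

lemma sections10_iff:
  "Z \<in> sections10 A J \<longleftrightarrow> re_field Z \<in> vector_fields A \<and> im_field Z \<in> vector_fields A
    \<and> endo_on J (re_field Z) = - im_field Z \<and> endo_on J (im_field Z) = re_field Z"
  unfolding sections10_def cvector_fields_def cendo_on_def cext_def
  by (simp add: fun_eq_iff complex_eq_iff) (auto simp: re_field_def im_field_def)

lemma cendo_on_cnj:
  assumes "\<And>X. X \<in> vector_fields A \<Longrightarrow> endo_on J (- X) = - endo_on J X" "Z \<in> sections10 A J"
  shows "cendo_on J (cnj_field Z) = (\<lambda>p f. - \<i> * cnj_field Z p f)"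
proof -
  have "endo_on J (re_field Z) = - im_field Z" "endo_on J (- im_field Z) = - re_field Z"
    using assms by (simp_all add: sections10_iff)
  then show ?thesis
    by (simp add: cendo_on_def cext_def fun_eq_iff complex_eq_iff)
       (simp add: re_field_def im_field_def cnj_field_def)
qed

lemma proj_sections10:
  assumes "Z \<in> sections10 A J"
  shows "proj10 J Z = Z" "proj01 J Z = 0"
  using assms by (simp_all add: sections10_def proj10_def proj01_def fun_eq_iff)

lemma proj_cnj_sections10:
  assumes "\<And>X. X \<in> vector_fields A \<Longrightarrow> endo_on J (- X) = - endo_on J X" "Z \<in> sections10 A J"
  shows "proj10 J (cnj_field Z) = 0" "proj01 J (cnj_field Z) = cnj_field Z"
  using cendo_on_cnj[OF assms] by (simp_all add: proj10_def proj01_def fun_eq_iff)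

text \<open>With the witness \<open>X - \<i> J X\<close>, every real field is the real part of a
  (1,0) section; quantifiers over sections can thus be exchanged for quantifiers over real
  fields.\<close>

lemma sections10_surj:
  assumes "X \<in> vector_fields A" "endo_on J X \<in> vector_fields A" "- endo_on J X \<in> vector_fields A"
    "endo_on J (- endo_on J X) = X"
  obtains Z where "Z \<in> sections10 A J" "re_field Z = X" "im_field Z = - endo_on J X"
proof -
  let ?Z = "\<lambda>p f. Complex (X p f) (- endo_on J X p f)"
  have *: "re_field ?Z = X" "im_field ?Z = - endo_on J X"
    by (simp_all add: re_field_def im_field_def fun_eq_iff)
  then have "?Z \<in> sections10 A J"
    using assms by (simp add: sections10_iff)
  with that show ?thesis using * by blast
qed

section \<open>Transfer of the abstract equivalences to the manifold\<close>

theorem theorem1p1: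
  fixes A :: "('a::{t2_space,second_countable_topology}, 'e::euclidean_space) chart set"
    and g :: "'a \<Rightarrow> 'a tvec \<Rightarrow> 'a tvec \<Rightarrow> real"
    and J :: "'a \<Rightarrow> 'a tvec \<Rightarrow> 'a tvec"
    and nabla canon :: "'a connection"
  assumes "smooth_atlas A"
    and "quasi_kaehler A g J"
    and "levi_civita A g nabla"
    and "canonical_connection A g J canon"
  shows
    "(\<forall>X\<in>vector_fields A. \<forall>Y\<in>vector_fields A. \<forall>Z\<in>vector_fields A. \<forall>W\<in>vector_fields A.
        curvature g canon X Y Z W + curvature g canon Y Z X W + curvature g canon Z X Y W = 0)
     \<longleftrightarrow>
     (\<forall>Z1\<in>sections10 A J. \<forall>Z2\<in>sections10 A J. \<forall>Z3\<in>sections10 A J. \<forall>Z4\<in>sections10 A J.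
        tensor4_c (curvature g nabla) (cnj_field Z1) Z2 Z3 Z4 = 0) \<and>
     (\<forall>Z1\<in>sections10 A J. \<forall>Z2\<in>sections10 A J. \<forall>Z3\<in>sections10 A J. \<forall>Z4\<in>sections10 A J. \<forall>p.
        tensor4_c (curvature g nabla) Z1 Z2 (cnj_field Z3) (cnj_field Z4) p =
        1 / 4 * tensor4_c (nijenhuis_deriv g J nabla) (cnj_field Z3) Z1 Z2 (cnj_field Z4) p)"
proof -
  let ?V = "vector_fields A"
  have ah: "almost_hermitian A g J" using assms(2) by (simp add: quasi_kaehler_def)
  have g: "riemannian_metric A g" and J: "almost_complex_structure A J"
    using ah by (simp_all add: almost_hermitian_def)
  have D: "linear_connection A nabla" and E: "linear_connection A canon"
    using assms(3,4) by (simp_all add: levi_civita_def canonical_connection_def)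
  have J_V: "endo_on J X \<in> ?V" if "X \<in> ?V" for X
    using J that by (simp add: almost_complex_structure_def)
  have J_J: "endo_on J (endo_on J X) = - X" if "X \<in> ?V" for X
  proof -
    have "J p (J p (X p)) = - X p" for p
      using J vector_fieldsD(1)[OF that] unfolding almost_complex_structure_def by blast
    then show ?thesis by (simp add: endo_on_def fun_eq_iff)
  qed
  \<comment> \<open>All clauses of \<open>linear_connection\<close> stand under a quantifier over
    smooth functions, so extracting any of them takes one such function.\<close>
  have smooth: "smooth_fun A (metric_on g X X)" if "X \<in> ?V" for X
    using g that by (simp add: riemannian_metric_def)
  have D_V: "nabla X Y \<in> ?V" if "X \<in> ?V" "Y \<in> ?V" for X Y
    using D that smooth unfolding linear_connection_def by blast
  have E_V: "canon X Y \<in> ?V" if "X \<in> ?V" "Y \<in> ?V" for X Y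
    using E that smooth unfolding linear_connection_def by blast
  have br_D: "bracket X Y = nabla X Y - nabla Y X" if "X \<in> ?V" "Y \<in> ?V" for X Y
  proof -
    have "torsion nabla X Y = 0" using assms(3) that by (simp add: levi_civita_def)
    then show ?thesis unfolding torsion_def by (metis eq_iff_diff_eq_0)
  qed
  have uminus_V: "- X \<in> ?V" if "X \<in> ?V" for X
    using J_V[OF J_V[OF that]] J_J[OF that] by simp
  \<comment> \<open>Torsion-freeness writes the bracket as a difference of covariant derivatives,
    which are fields.\<close>
  have br_V: "bracket X Y \<in> ?V" if "X \<in> ?V" "Y \<in> ?V" for X Y
    using vector_fields_add[OF assms(1), of "nabla X Y" "- nabla Y X"] uminus_V D_V br_D that by simp
  interpret almost_hermitian_pair ?V "metric_on g" deriv_along "endo_on J" bracket nabla canon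
  proof
    fix X Y Z :: "'a field" and p
    assume X: "X \<in> ?V" and Y: "Y \<in> ?V"
    show "X + Y \<in> ?V" using vector_fields_add[OF assms(1)] X Y .
    show "endo_on J X \<in> ?V" by (rule J_V[OF X])
    show "nabla X Y \<in> ?V" "canon X Y \<in> ?V"
      using D_V E_V X Y by blast+
    show "endo_on J (X + Y) = endo_on J X + endo_on J Y"
      using J vector_fieldsD(1)[OF X] vector_fieldsD(1)[OF Y]
      by (simp add: almost_complex_structure_def endo_on_def fun_eq_iff)
    show "endo_on J (endo_on J X) = - X" by (rule J_J[OF X])
    show "metric_on g X Y p = metric_on g Y X p"
      using g vector_fieldsD(1)[OF X] vector_fieldsD(1)[OF Y]
      unfolding riemannian_metric_def metric_on_def by blast
    show "metric_on g (endo_on J X) (endo_on J Y) p = metric_on g X Y p"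
      using ah vector_fieldsD(1)[OF X] vector_fieldsD(1)[OF Y]
      by (simp add: almost_hermitian_def metric_on_def endo_on_def)
    show "bracket X Y = nabla X Y - nabla Y X" by (rule br_D[OF X Y])
    show "canon X (endo_on J Y) = endo_on J (canon X Y)"
      using assms(4) X Y by (simp add: canonical_connection_def cov_endo_def)
    assume Z: "Z \<in> ?V"
    \<comment> \<open>\<open>riemannian_metric\<close> states additivity in the second argument;
      symmetry carries it over.\<close>
    show "metric_on g (X + Y) Z p = metric_on g X Z p + metric_on g Y Z p"
    proof -
      have sym: "g p u v = g p v u" and add: "g p u (v + w) = g p u v + g p u w"
        if "u \<in> tangent_space A p" "v \<in> tangent_space A p" "w \<in> tangent_space A p" for u v w
        using g that unfolding riemannian_metric_def by blast+
      have "X p + Y p \<in> tangent_space A p"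
        using vector_fieldsD(1)[OF vector_fields_add[OF assms(1) X Y], of p] by simp
      then show ?thesis
        using add[of "Z p" "X p" "Y p"] sym[of "Z p"]
          vector_fieldsD(1)[OF X] vector_fieldsD(1)[OF Y] vector_fieldsD(1)[OF Z]
        by (simp add: metric_on_def)
    qed
    show "nabla (X + Y) Z = nabla X Z + nabla Y Z" "nabla X (Y + Z) = nabla X Y + nabla X Z"
      "canon (X + Y) Z = canon X Z + canon Y Z" "canon X (Y + Z) = canon X Y + canon X Z"
      using D E X Y Z smooth[OF X] unfolding linear_connection_def by blast+
    have "cov_metric nabla g X Y Z p = 0"
      using assms(3) X Y Z by (simp add: levi_civita_def)
    then show "deriv_along X (metric_on g Y Z) p = metric_on g (nabla X Y) Z p + metric_on g Y (nabla X Z) p"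
      by (simp add: cov_metric_def)
    have "cov_metric canon g X Y Z p = 0"
      using assms(4) X Y Z by (simp add: canonical_connection_def)
    then show "deriv_along X (metric_on g Y Z) p = metric_on g (canon X Y) Z p + metric_on g Y (canon X Z) p"
      by (simp add: cov_metric_def)
    show "bracket X (bracket Y Z) + bracket Y (bracket Z X) + bracket Z (bracket X Y) = 0"
      using bracket_jacobi[OF br_V X Y Z] .
  next
    fix X assume X: "X \<in> ?V" and 0: "\<And>Y p. Y \<in> ?V \<Longrightarrow> metric_on g X Y p = 0"
    have "X p \<noteq> 0 \<Longrightarrow> metric_on g X X p > 0" for p
      using g vector_fieldsD(1)[OF X, of p] unfolding riemannian_metric_def metric_on_def by blast
    with 0[OF X] have "X p = 0" for p by (metis less_irrefl)
    then show "X = 0" by (simp add: fun_eq_iff)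
  qed
  have torsion: "torsion canon X Y = T X Y" for X Y
    by (simp add: torsion_def T_def)
  have dw: "ext_deriv2 (fundamental_form g J) X Y Z p = dw X Y Z p" for X Y Z p
    by (simp add: ext_deriv2_def dw_def fundamental_form_def)
  have sec: "\<exists>Z\<in>sections10 A J. re_field Z = X \<and> im_field Z = - endo_on J X" if "X \<in> ?V" for X
    using that sections10_surj[of X A J] by (metis J_J J_V J_minus minus_minus uminus_V)
  have csec: "Z \<in> cvector_fields A" "cnj_field Z \<in> cvector_fields A" if "Z \<in> sections10 A J" for Z
    using that by (auto simp: sections10_iff cvector_fields_def)
  interpret quasi_kaehler_pair ?V "metric_on g" deriv_along "endo_on J" bracket nabla canon
  proof
    fix X Y assume X: "X \<in> ?V" and Y: "Y \<in> ?V"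
    obtain Z1 Z2 where Z: "Z1 \<in> sections10 A J" "Z2 \<in> sections10 A J"
      and ri: "re_field Z1 = X" "im_field Z1 = - endo_on J X"
        "re_field Z2 = Y" "im_field Z2 = - endo_on J Y"
      using sec[OF X] sec[OF Y] by blast
    \<comment> \<open>For arguments of types (1,0) and (0,1) the other summand of
      \<open>part11\<close> is evaluated at zero fields.\<close>
    have "part11 J (torsion canon) Z1 (cnj_field Z2) p f = 0" for p f
      using assms(4) csec Z by (simp add: canonical_connection_def)
    then have "form2_cvalued (torsion canon) Z1 (cnj_field Z2) p f + form2_cvalued (torsion canon) 0 0 p f = 0" for p f
      using Z by (simp add: part11_def proj_sections10 proj_cnj_sections10[OF J_minus])
    from this[THEN arg_cong[of _ _ Re]]
    have "T X Y p f + T (endo_on J X) (endo_on J Y) p f = 0" for p f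
      using X Y by (simp add: form2_cvalued_def cext2_def cext_def ri torsion T_zero[OF X])
    then show "T (endo_on J X) (endo_on J Y) = - T X Y"
      by (simp add: fun_eq_iff add_eq_0_iff)
  next
    fix X Y Z p assume X: "X \<in> ?V" and Y: "Y \<in> ?V" and Z: "Z \<in> ?V"
    obtain Z1 Z2 Z3 where s: "Z1 \<in> sections10 A J" "Z2 \<in> sections10 A J" "Z3 \<in> sections10 A J"
      and ri: "re_field Z1 = X" "im_field Z1 = - endo_on J X"
        "re_field Z2 = Y" "im_field Z2 = - endo_on J Y"
        "re_field Z3 = Z" "im_field Z3 = - endo_on J Z"
      using sec[OF X] sec[OF Y] sec[OF Z] by blast
    let ?d = "ext_deriv2 (fundamental_form g J)"
    \<comment> \<open>With these types the last two summands of \<open>part12\<close> have zero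
      arguments; the real part of the first is \<open>dw_12\<close>.\<close>
    have "part12 J ?d Z1 (cnj_field Z2) (cnj_field Z3) p = 0"
      using assms(2) csec s by (simp add: quasi_kaehler_def)
    then have "form3_c ?d Z1 (cnj_field Z2) (cnj_field Z3) p
        + form3_c ?d 0 0 (cnj_field Z3) p + form3_c ?d 0 (cnj_field Z2) 0 p = 0"
      using s by (simp add: part12_def proj_sections10 proj_cnj_sections10[OF J_minus])
    from this[THEN arg_cong[of _ _ Re]]
    show "dw X Y Z p + dw (endo_on J X) (endo_on J Y) Z p + dw (endo_on J X) Y (endo_on J Z) p
        - dw X (endo_on J Y) (endo_on J Z) p = 0"
      using X Y Z by (simp add: form3_c_def cext3_def cext2_def cext_def ri dw dw_zero dw_minus)
  next
    show "x + x = 0 \<Longrightarrow> x = 0" for x :: "'a field"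
      by (simp add: fun_eq_iff)
  qed
  have R: "curvature g nabla X Y Z W p = metric_on g (R X Y Z) W p" for X Y Z W p
    by (simp add: curvature_def R_def)
  have K: "curvature g canon X Y Z W p = metric_on g (K X Y Z) W p" for X Y Z W p
    by (simp add: curvature_def K_def)
  have DN: "nijenhuis_deriv g J nabla X Y Z W p = metric_on g (DN X Y Z) W p" for X Y Z W p
    by (simp add: nijenhuis_deriv_def cov_tensor2_def nijenhuis_def DN_def N_def)
  \<comment> \<open>The imaginary part of a (1,0) section is \<open>- J\<close> of its real part, so
    complex extension depends on the real part alone.\<close>
  have cext: "cext \<tau> Z = c1 \<tau> (re_field Z)" "cext \<tau> (cnj_field Z) = c0 \<tau> (re_field Z)"
    if "Z \<in> sections10 A J" for \<tau> Z
    using that by (simp_all add: sections10_iff cext_def c1_def c0_def)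
  have ball: "(\<forall>Z\<in>sections10 A J. Q (re_field Z)) \<longleftrightarrow> (\<forall>X\<in>?V. Q X)" for Q
    using sec by (metis sections10_iff)
  have "(\<forall>X\<in>?V. \<forall>Y\<in>?V. \<forall>Z\<in>?V. \<forall>W\<in>?V.
        curvature g canon X Y Z W + curvature g canon Y Z X W + curvature g canon Z X Y W = 0)
     \<longleftrightarrow> (\<forall>X\<in>?V. \<forall>Y\<in>?V. \<forall>Z\<in>?V. K X Y Z + K Y Z X + K Z X Y = 0)"
    (is "?l \<longleftrightarrow> ?r")
  proof
    assume l: ?l
    show ?r
    proof (intro ballI g_nondegenerate)
      fix X Y Z W p assume "X \<in> ?V" "Y \<in> ?V" "Z \<in> ?V" "W \<in> ?V"
      then show "metric_on g (K X Y Z + K Y Z X + K Z X Y) W p = 0"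
        using l by (simp add: fun_eq_iff K)
    qed simp
  next
    assume ?r
    show ?l
    proof (intro ballI)
      fix X Y Z W assume V: "X \<in> ?V" "Y \<in> ?V" "Z \<in> ?V" "W \<in> ?V"
      then have "metric_on g (K X Y Z + K Y Z X + K Z X Y) W p = 0" for p
        using \<open>?r\<close> by simp
      then show "curvature g canon X Y Z W + curvature g canon Y Z X W + curvature g canon Z X Y W = 0"
        using V by (simp add: fun_eq_iff K)
    qed
  qed
  also have "\<dots> \<longleftrightarrow>
    (\<forall>X\<in>?V. \<forall>Y\<in>?V. \<forall>Z\<in>?V. \<forall>W\<in>?V. \<forall>p.
      c0 (\<lambda>X. c1 (\<lambda>Y. c1 (\<lambda>Z. c1 (\<lambda>W. complex_of_real (metric_on g (R X Y Z) W p)) W) Z) Y) X = 0) \<and>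
    (\<forall>X\<in>?V. \<forall>Y\<in>?V. \<forall>Z\<in>?V. \<forall>W\<in>?V. \<forall>p.
      c1 (\<lambda>X. c1 (\<lambda>Y. c0 (\<lambda>Z. c0 (\<lambda>W. complex_of_real (metric_on g (R X Y Z) W p)) W) Z) Y) X =
      1 / 4 * c0 (\<lambda>a. c1 (\<lambda>b. c1 (\<lambda>c. c0 (\<lambda>d. complex_of_real (metric_on g (DN a b c) d p)) W) Y) X) Z)"
    unfolding third_gray_iff nijenhuis_deriv_iff bianchi_iff EC_iff_ET ..
  finally show ?thesis
    by (simp add: tensor4_c_def cext4_def cext3_def cext2_def cext R DN fun_eq_iff flip: ball)
qed

end
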